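(* Let $c>0$ and $m\ge 1$ be integers, let $r=[2c,-2c,\ldots,(-1)^{m-1}2c]$ (with $m$ entries of alternating sign), and let $K(r)$ be the corresponding two-bridge knot (or two-component two-bridge link). Then every zero $\alpha$ of the Alexander polynomial $\Delta_{K(r)}(t)$ is real and satisfies $$\left(\frac{\sqrt{1+c^2}-1}{c}\right)^2<\alpha<\left(\frac{\sqrt{1+c^2}+1}{c}\right)^2.$$
   Context: For nonzero integers $a_1,\ldots,a_m$, the notation $[2a_1,\ldots,2a_m]$ denotes the even negative continued fraction $$[2a_1,2a_2,\ldots,2a_m]:=\cfrac{1}{2a_1-\cfrac{1}{2a_2-\cfrac{1}{\ddots-\cfrac{1}{2a_m}}}}.$$ $K(r)$ denotes the two-bridge knot ($m$ even) or two-component two-bridge link ($m$ odd) identified by the rational number $r$. The expansion gives a diagram of $K(r)$ and a minimal genus Seifert surface whose Seifert matrix is the $m\times m$ matrix $U=(u_{ij})$ with $u_{ii}=a_i$ for all $i$; $u_{i,i-1}=-1$ for every even $i$ with $2\le i\le m$; $u_{i,i+1}=1$ for every even $i$ with $i+1\le m$; and all other entries $0$. The Alexander polynomial is $\Delta_{K(r)}(t)=\det(tU-U^T)$ with this $U$. In the claim, $a_i=(-1)^{i-1}c$. *)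

theory Defs
  imports Complex_Main "Jordan_Normal_Form.Determinant"
begin

fun neg_cf :: "int list \<Rightarrow> rat" where
  "neg_cf [] = 0"
| "neg_cf (b # bs) = 1 / (of_int b - neg_cf bs)"

text \<open>A list \<open>as\<close> of nonzero integers stands for the expansion \<open>[2 a\<^sub>1, \<dots>, 2 a\<^sub>m]\<close>.\<close>

definition is_even_expansion :: "int list \<Rightarrow> rat \<Rightarrow> bool" where
  "is_even_expansion as r \<longleftrightarrow>
     as \<noteq> [] \<and> 0 \<notin> set as \<and> neg_cf (map (\<lambda>a. 2 * a) as) = r"

text \<open>Such an expansion is unique, so that objects built from it depend on the rational only.\<close>

lemma neg_cf_even_abs_less_1:
  "0 \<notin> set as \<Longrightarrow> \<bar>neg_cf (map (\<lambda>a. 2 * a) as)\<bar> < 1"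
proof (induction as)
  case Nil
  then show ?case by simp
next
  case (Cons a as)
  define s where "s = neg_cf (map (\<lambda>a. 2 * a) as)"
  have s: "\<bar>s\<bar> < 1" using Cons by (simp add: s_def)
  have "\<bar>a\<bar> \<ge> 1" using Cons.prems by auto
  then have "\<bar>of_int a :: rat\<bar> \<ge> 1"
    by (metis of_int_1_le_iff of_int_abs)
  then have "\<bar>2 * of_int a - s\<bar> > 1" using s by linarith
  then show ?case by (simp add: s_def[symmetric])
qed

lemma neg_cf_even_Cons_nonzero:
  assumes "0 \<notin> set (a # as)"
  shows "neg_cf (map (\<lambda>a. 2 * a) (a # as)) \<noteq> 0"
proof -
  define s where "s = neg_cf (map (\<lambda>a. 2 * a) as)"
  have s: "\<bar>s\<bar> < 1" using neg_cf_even_abs_less_1 assms by (simp add: s_def)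
  have "\<bar>a\<bar> \<ge> 1" using assms by auto
  then have "\<bar>of_int a :: rat\<bar> \<ge> 1"
    by (metis of_int_1_le_iff of_int_abs)
  then have "2 * of_int a - s \<noteq> 0" using s by linarith
  then show ?thesis by (simp add: s_def[symmetric])
qed

lemma neg_cf_even_inj:
  assumes "0 \<notin> set as" "0 \<notin> set bs"
    and "neg_cf (map (\<lambda>a. 2 * a) as) = neg_cf (map (\<lambda>a. 2 * a) bs)"
  shows "as = bs"
  using assms
proof (induction as arbitrary: bs)
  case Nil
  then show ?case
    using neg_cf_even_Cons_nonzero by (cases bs) (auto simp del: neg_cf.simps(2) list.map(2))
next
  case (Cons a as)
  obtain b bs' where bs: "bs = b # bs'"
    using Cons.prems neg_cf_even_Cons_nonzero[of a as] by (cases bs) auto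
  define s t where "s = neg_cf (map (\<lambda>a. 2 * a) as)" and "t = neg_cf (map (\<lambda>a. 2 * a) bs')"
  have st: "\<bar>s\<bar> < 1" "\<bar>t\<bar> < 1"
    using neg_cf_even_abs_less_1 Cons.prems bs by (auto simp: s_def t_def)
  have eq: "2 * of_int a - s = 2 * of_int b - t"
    using Cons.prems(3) by (simp add: bs s_def t_def)
  then have "\<bar>of_int a - of_int b :: rat\<bar> < 1" using st by linarith
  then have "\<bar>of_int (a - b) :: rat\<bar> < 1" by simp
  then have "\<bar>a - b\<bar> < 1"
    by (metis of_int_abs of_int_less_1_iff)
  then have "a = b" by simp
  then show ?case using eq Cons.IH[of bs'] Cons.prems bs by (simp add: s_def t_def)
qed

lemma is_even_expansion_unique:
  "is_even_expansion as r \<Longrightarrow> is_even_expansion bs r \<Longrightarrow> as = bs"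
  using neg_cf_even_inj by (auto simp: is_even_expansion_def)

definition even_expansion :: "rat \<Rightarrow> int list" where
  "even_expansion r = (THE as. is_even_expansion as r)"

lemma even_expansion_eqI: "is_even_expansion as r \<Longrightarrow> even_expansion r = as"
  unfolding even_expansion_def by (blast intro: is_even_expansion_unique)

text \<open>
  Seifert matrix of the minimal genus Seifert surface of the two-bridge knot or link given by
  \<open>[2 a\<^sub>1, \<dots>, 2 a\<^sub>m]\<close>. Matrix and list indices start at 0 here, so the rows with an
  even index in the usual numbering from 1 are those with \<open>odd i\<close>.
\<close>

definition seifert_matrix :: "int list \<Rightarrow> int mat" where
  "seifert_matrix as = mat (length as) (length as) (\<lambda>(i, j).
     if i = j then as ! i
     else if odd i \<and> i = j + 1 then -1
     else if odd i \<and> j = i + 1 then 1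
     else 0)"

text \<open>The polynomial \<open>det (t U - U\<^sup>T)\<close>, with \<open>[:0, 1:]\<close> as the indeterminate \<open>t\<close>.\<close>

definition seifert_alexander_poly :: "int mat \<Rightarrow> int poly" where
  "seifert_alexander_poly U =
     det ([:0, 1:] \<cdot>\<^sub>m map_mat (\<lambda>x. [:x:]) U - map_mat (\<lambda>x. [:x:]) (transpose_mat U))"

text \<open>
  Alexander polynomial of the two-bridge knot or link \<open>K(r)\<close>, for a rational \<open>r\<close> that has
  an even expansion (and unspecified otherwise).
\<close>

definition two_bridge_alexander_poly :: "rat \<Rightarrow> int poly" where
  "two_bridge_alexander_poly r = seifert_alexander_poly (seifert_matrix (even_expansion r))"

end

theory Submission imports Defs "Jordan_Normal_Form.Char_Poly" begin

text \<open>
  If \<open>t\<close> is a zero, \<open>t U - U\<^sup>T\<close> has a nonzero kernel vector, whose entries, padded by zeros on both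
  sides, satisfy a three-term recurrence. Pairing the recurrence with the conjugate vector telescopes
  to \<open>cnj \<mu> * E = \<mu> / t * O\<close>, where \<open>\<mu> = (t - 1) c\<close> and \<open>E\<close>, \<open>O\<close> are the squared norms of
  the two parity classes of entries; unless \<open>t = 1\<close>, this forces \<open>t\<close> to be real and positive. Rescaling one parity
  class by \<open>sqrt t\<close>, the absolute values \<open>y\<close> satisfy \<open>\<beta> * y k \<le> y (k - 1) + y (k + 1)\<close> with
  \<open>\<beta> = \<bar>t - 1\<bar> c / sqrt t\<close>. If \<open>\<beta> \<ge> 2\<close>, then \<open>y\<close> would be convex, hence strictly increasing, and could
  not return to zero. So \<open>\<bar>t - 1\<bar> c < 2 sqrt t\<close>, which is the claim.
\<close>

lemma coefficient_less_2:
  fixes y :: "nat \<Rightarrow> real"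
  assumes y0: "y 0 = 0" and end0: "y (Suc m) = 0" and nonneg: "\<And>k. y k \<ge> 0" and y1: "y 1 > 0"
    and rec: "\<And>k. k < m \<Longrightarrow> \<beta> * y (Suc k) \<le> y k + y (Suc (Suc k))"
  shows "\<beta> < 2"
proof (rule ccontr)
  assume "\<not> \<beta> < 2"
  have "y k < y (Suc k)" if "k \<le> m" for k
    using that
  proof (induction k)
    case (Suc k)
    have "2 * y (Suc k) \<le> \<beta> * y (Suc k)"
      using \<open>\<not> \<beta> < 2\<close> nonneg by (intro mult_right_mono) auto
    then show ?case using Suc rec[of k] by simp
  qed (use y0 y1 in simp)
  from this[of m] show False using end0 nonneg[of m] by simp
qed

text \<open>The kernel equations of \<open>t U - U\<^sup>T\<close> for the diagonal
  \<open>c, -c, c, \<dots>\<close>. Entries are numbered from 1, which leaves 0 and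
  \<open>Suc m\<close> for the padding, while \<open>k\<close> numbers the rows from 0: row
  \<open>k\<close> is centred at \<open>w (Suc k)\<close>.\<close>

locale alternating_recurrence =
  fixes c :: real and t :: complex and m :: nat and w :: "nat \<Rightarrow> complex"
  assumes c_pos: "c > 0" and w_0: "w 0 = 0" and w_end: "w (Suc m) = 0"
    and w_nonzero: "\<exists>k\<le>m. w k \<noteq> 0"
    and even_rec: "\<And>k. k < m \<Longrightarrow> even k \<Longrightarrow> w (Suc (Suc k)) - w k = - ((t - 1) * c * w (Suc k))"
    and odd_rec: "\<And>k. k < m \<Longrightarrow> odd k \<Longrightarrow> t * (w (Suc (Suc k)) - w k) = (t - 1) * c * w (Suc k)"
begin

text \<open>At \<open>t = 0\<close> the odd rows alone force the even-indexed entries to vanish, and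
  the even rows then force the others to vanish.\<close>

lemma t_nonzero: "t \<noteq> 0"
proof
  assume t: "t = 0"
  have even_0: "w k = 0" if "even k" "k \<le> m" for k
    using that odd_rec[of "k - 1"] w_0 c_pos t by (cases k) auto
  have "w k = 0" if "k \<le> m" for k
  proof (cases "even k")
    case False
    then obtain j where j: "k = Suc j" "even j" by (cases k) auto
    have "w (Suc k) = 0"
      using even_0[of "Suc k"] w_end False that by (cases "k = m") auto
    then show ?thesis
      using even_rec[of j] even_0[of j] that j c_pos t by simp
  qed (use even_0 that in simp)
  then show False using w_nonzero by blast
qed

text \<open>Since \<open>t\<close> is nonzero, every row can be solved for
  \<open>w (Suc (Suc k))\<close>, so \<open>w 0\<close> and \<open>w 1\<close> determine all
  entries.\<close>

lemma w_1_nonzero: "w 1 \<noteq> 0"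
proof
  assume "w 1 = 0"
  have "w k = 0 \<and> w (Suc k) = 0" if "k \<le> m" for k
    using that
  proof (induction k)
    case (Suc k)
    then show ?case
      using even_rec[of k] odd_rec[of k] t_nonzero by (cases "even k") auto
  qed (use w_0 \<open>w 1 = 0\<close> in simp)
  then show False using w_nonzero by blast
qed

lemma real_positive:
  assumes "t \<noteq> 1"
  shows "t \<in> \<real>" "Re t > 0"
proof -
  \<comment> \<open>The boundary term of the telescoping. Always conjugating the even-indexed factor
    makes \<open>Z (Suc n) - Z n\<close> the product of one entry and one difference, up to
    conjugation, to which row \<open>n\<close> applies. \<open>E\<close> and \<open>Od\<close> are
    named after the parity of the row, so \<open>E\<close> collects the odd-indexed entries.\<close>
  define Z where "Z k = (if odd k then w k * cnj (w (Suc k)) else cnj (w k) * w (Suc k))" for k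
  define E where "E n = (\<Sum>k<n. if even k then (cmod (w (Suc k)))\<^sup>2 else 0)" for n
  define Od where "Od n = (\<Sum>k<n. if odd k then (cmod (w (Suc k)))\<^sup>2 else 0)" for n
  have "t * Z n = - (t * cnj (t - 1) * c * E n) + (t - 1) * c * Od n" if "n \<le> m" for n
    using that
  proof (induction n)
    case (Suc n)
    have sq: "w k * cnj (w k) = complex_of_real ((cmod (w k))\<^sup>2)" for k
      by (metis complex_norm_square)
    show ?case
    proof (cases "even n")
      case True
      have "t * Z (Suc n) - t * Z n = t * w (Suc n) * cnj (w (Suc (Suc n)) - w n)"
        using True by (simp add: Z_def algebra_simps)
      also have "\<dots> = - (t * cnj (t - 1) * c * (w (Suc n) * cnj (w (Suc n))))"
        using even_rec[of n] True Suc.prems by (simp add: mult_ac)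
      finally show ?thesis
        using Suc True unfolding sq by (simp add: E_def Od_def algebra_simps)
    next
      case False
      have "t * Z (Suc n) - t * Z n = cnj (w (Suc n)) * (t * (w (Suc (Suc n)) - w n))"
        using False by (simp add: Z_def algebra_simps)
      also have "\<dots> = (t - 1) * c * (w (Suc n) * cnj (w (Suc n)))"
        using odd_rec[of n] False Suc.prems by (simp add: mult_ac)
      finally show ?thesis
        using Suc False unfolding sq by (simp add: E_def Od_def algebra_simps)
    qed
  qed (simp add: Z_def E_def Od_def w_0)
  \<comment> \<open>\<open>Z m\<close> contains the factor \<open>w (Suc m) = 0\<close>, possibly
    conjugated.\<close>
  from this[of m] have "complex_of_real c * (t * cnj (t - 1) * E m) = complex_of_real c * ((t - 1) * Od m)"
    using w_end by (simp add: Z_def algebra_simps split: if_splits)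
  then have eq: "t * cnj (t - 1) * E m = (t - 1) * Od m"
    using c_pos by simp
  have "m > 0" using w_nonzero w_0 by (cases m) auto
  have "(cmod (w 1))\<^sup>2 \<le> E m"
    unfolding E_def using \<open>m > 0\<close> member_le_sum[of 0 "{..<m}" "\<lambda>k. if even k then (cmod (w (Suc k)))\<^sup>2 else 0"]
    by simp
  then have E_pos: "E m > 0" using w_1_nonzero by (smt (verit) zero_less_norm_iff zero_less_power)
  have Od_nonneg: "Od m \<ge> 0" unfolding Od_def by (intro sum_nonneg) auto
  \<comment> \<open>Here \<open>t * cnj (t - 1) = t * cnj t - t\<close>, and
    \<open>t * cnj t\<close> is real.\<close>
  have "Im (t * cnj (t - 1) * E m) = - Im t * E m"
    by (simp add: algebra_simps)
  then have "Im t * (E m + Od m) = 0"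
    using arg_cong[OF eq, of Im] by (simp add: algebra_simps)
  then have Im_0: "Im t = 0" using E_pos Od_nonneg by simp
  then show "t \<in> \<real>" by (simp add: complex_is_Real_iff)
  have "(Re t - 1) * (Re t * E m) = (Re t - 1) * Od m"
    using arg_cong[OF eq, of Re] Im_0 by (simp add: algebra_simps)
  moreover have "Re t \<noteq> 1" using assms Im_0 by (auto simp: complex_eq_iff)
  ultimately have "Re t * E m = Od m" by simp
  then have "Re t \<ge> 0" using E_pos Od_nonneg by (metis zero_le_mult_iff not_less)
  moreover have "Re t \<noteq> 0" using t_nonzero Im_0 by (auto simp: complex_eq_iff)
  ultimately show "Re t > 0" by simp
qed

lemma bound:
  assumes t: "t = complex_of_real (s\<^sup>2)" and s: "s > 0"
  shows "\<bar>s\<^sup>2 - 1\<bar> * c < 2 * s"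
proof -
  \<comment> \<open>Even rows bound the middle entry with factor 1 on its neighbours, odd rows with
    factor \<open>s\<^sup>2\<close>. Dividing the even-indexed entries by \<open>s\<close> turns
    both factors into \<open>s\<close>.\<close>
  define y where "y k = (if odd k then cmod (w k) else cmod (w k) / s)" for k
  have cm: "cmod ((t - 1) * c * z) = \<bar>s\<^sup>2 - 1\<bar> * c * cmod z" for z
  proof -
    have "(t - 1) * c * z = complex_of_real ((s\<^sup>2 - 1) * c) * z" by (simp add: t)
    then show ?thesis using c_pos by (simp only: norm_mult norm_of_real abs_mult abs_of_pos)
  qed
  have "\<bar>s\<^sup>2 - 1\<bar> * c / s < 2"
  proof (rule coefficient_less_2[of y m])
    fix k assume k: "k < m"
    show "\<bar>s\<^sup>2 - 1\<bar> * c / s * y (Suc k) \<le> y k + y (Suc (Suc k))"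
    proof (cases "even k")
      case True
      have "\<bar>s\<^sup>2 - 1\<bar> * c * cmod (w (Suc k)) = cmod (w (Suc (Suc k)) - w k)"
        using even_rec[OF k True] cm by (simp only: norm_minus_cancel)
      also have "\<dots> \<le> cmod (w (Suc (Suc k))) + cmod (w k)" by (rule norm_triangle_ineq4)
      finally show ?thesis using True s by (simp add: y_def field_simps)
    next
      case False
      have "\<bar>s\<^sup>2 - 1\<bar> * c * cmod (w (Suc k)) = s\<^sup>2 * cmod (w (Suc (Suc k)) - w k)"
        using arg_cong[OF odd_rec[OF k False], of cmod] cm[of "w (Suc k)"]
        by (simp only: t norm_mult[of "complex_of_real (s\<^sup>2)"] norm_of_real abs_power2)
      also have "\<dots> \<le> s\<^sup>2 * (cmod (w (Suc (Suc k))) + cmod (w k))"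
        by (intro mult_left_mono norm_triangle_ineq4) simp
      finally show ?thesis using False s by (simp add: y_def field_simps power2_eq_square)
    qed
  qed (use w_0 w_end w_1_nonzero s in \<open>auto simp: y_def\<close>)
  then show ?thesis using s by (simp add: field_simps)
qed

lemma location:
  "t \<in> \<real> \<and> ((sqrt (1 + c\<^sup>2) - 1) / c)\<^sup>2 < Re t \<and> Re t < ((sqrt (1 + c\<^sup>2) + 1) / c)\<^sup>2"
proof -
  define s where "s = sqrt (Re t)"
  define R where "R = sqrt (1 + c\<^sup>2)"
  have real: "t \<in> \<real>" and pos: "Re t > 0"
    using real_positive by (cases "t = 1"; simp)+
  have s: "s > 0" and s2: "s\<^sup>2 = Re t" using pos by (auto simp: s_def)
  have "t = complex_of_real (s\<^sup>2)" using real s2 by (simp add: complex_is_Real_iff complex_eq_iff)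
  then have "\<bar>s\<^sup>2 - 1\<bar> * c < 2 * s" using bound s by blast
  then have "(s\<^sup>2 - 1) * c < 2 * s" "(1 - s\<^sup>2) * c < 2 * s"
    using c_pos by (smt (verit) mult_right_mono)+
  \<comment> \<open>The extra factor \<open>c\<close> prepares for completing the squares
    \<open>(c * s - 1)\<^sup>2\<close> and \<open>(c * s + 1)\<^sup>2\<close>, each to be compared
    with \<open>1 + c\<^sup>2\<close>.\<close>
  then have b: "((s\<^sup>2 - 1) * c) * c < 2 * s * c" "((1 - s\<^sup>2) * c) * c < 2 * s * c"
    using c_pos by simp_all
  have R2: "R\<^sup>2 = 1 + c\<^sup>2" unfolding R_def by simp
  have R1: "R > 1" using c_pos by (simp add: R_def)
  have "(c * s - 1)\<^sup>2 < R\<^sup>2" using b unfolding R2 by (simp add: power2_eq_square algebra_simps)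
  then have "c * s - 1 < R" using R1 by (intro power2_less_imp_less[of _ R]) auto
  then have up: "s < (R + 1) / c" using c_pos by (simp add: field_simps)
  have "R\<^sup>2 < (c * s + 1)\<^sup>2" using b unfolding R2 by (simp add: power2_eq_square algebra_simps)
  then have "R < c * s + 1" using c_pos s by (intro power2_less_imp_less[of R]) auto
  then have low: "(R - 1) / c < s" using c_pos by (simp add: field_simps)
  have "s\<^sup>2 < ((R + 1) / c)\<^sup>2" using up s by (intro power_strict_mono) auto
  moreover have "((R - 1) / c)\<^sup>2 < s\<^sup>2" using low R1 c_pos by (intro power_strict_mono) auto
  ultimately show ?thesis using real s2 R_def by simp
qed

end

lemma even_expansion_neg_cf:
  assumes "as \<noteq> []" "0 \<notin> set as"
  shows "even_expansion (neg_cf (map (\<lambda>a. 2 * a) as)) = as"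
  using assms by (intro even_expansion_eqI) (simp add: is_even_expansion_def)

text \<open>Evaluation at \<open>t\<close> is a ring homomorphism and so commutes with the
  determinant; over a field, a zero determinant means a nontrivial kernel.\<close>

lemma seifert_alexander_poly_zero_iff:
  fixes t :: "'a :: field"
  assumes U: "U \<in> carrier_mat m m"
  shows "poly (map_poly of_int (seifert_alexander_poly U)) t = 0 \<longleftrightarrow>
    (\<exists>v. v \<in> carrier_vec m \<and> v \<noteq> 0\<^sub>v m \<and>
      mat m m (\<lambda>(i, j). t * of_int (U $$ (i, j)) - of_int (U $$ (j, i))) *\<^sub>v v = 0\<^sub>v m)"
proof -
  interpret h: comm_ring_hom "\<lambda>p :: int poly. poly (map_poly of_int p) t"
    by unfold_locales (simp_all add: of_int_poly_hom.hom_add of_int_poly_hom.hom_mult)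
  have "map_mat (\<lambda>p. poly (map_poly of_int p) t)
      ([:0, 1:] \<cdot>\<^sub>m map_mat (\<lambda>x. [:x:]) U - map_mat (\<lambda>x. [:x:]) (transpose_mat U))
    = mat m m (\<lambda>(i, j). t * of_int (U $$ (i, j)) - of_int (U $$ (j, i)))" (is "_ = ?M")
    using U by (intro eq_matI) (auto simp: of_int_hom.map_poly_pCons_hom)
  then have "poly (map_poly of_int (seifert_alexander_poly U)) t = det ?M"
    unfolding seifert_alexander_poly_def by (metis h.hom_det)
  then show ?thesis using det_0_iff_vec_prod_zero_field[of ?M m] by simp
qed

text \<open>The zero padding gives the first and last rows the same three-term form as the inner
  ones.\<close>

lemma sum_tridiagonal:
  fixes x :: "nat \<Rightarrow> 'a :: comm_ring_1"
  assumes "i < m"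
    and "\<And>j. j < m \<Longrightarrow> f j = (if j = i then b else if i = Suc j then a else if j = Suc i then d else 0)"
    and x: "x 0 = 0" "x (Suc m) = 0"
  shows "(\<Sum>j<m. f j * x (Suc j)) = a * x i + b * x (Suc i) + d * x (Suc (Suc i))"
proof -
  have "(\<Sum>j<m. f j * x (Suc j)) = (\<Sum>j<m. if j = i then b * x (Suc j) else 0)
      + (\<Sum>j<m. if i = Suc j then a * x (Suc j) else 0)
      + (\<Sum>j<m. if j = Suc i then d * x (Suc j) else 0)"
    unfolding sum.distrib[symmetric] by (intro sum.cong) (auto simp: assms(2))
  also have "(\<Sum>j<m. if j = i then b * x (Suc j) else 0) = b * x (Suc i)"
    using assms(1) by simp
  also have "(\<Sum>j<m. if i = Suc j then a * x (Suc j) else 0) = a * x i"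
    using assms(1) x by (cases i) auto
  also have "(\<Sum>j<m. if j = Suc i then d * x (Suc j) else 0) = d * x (Suc (Suc i))"
    using assms(1) x by (cases "Suc i = m") auto
  finally show ?thesis by simp
qed

theorem theorem5:
  fixes c :: int and m :: nat and r :: rat and \<alpha> :: complex
  assumes "c > 0" and "m \<ge> 1"
    and "r = neg_cf (map (\<lambda>i. (-1) ^ i * (2 * c)) [0..<m])"
    and "poly (map_poly of_int (two_bridge_alexander_poly r)) \<alpha> = 0"
  shows "\<alpha> \<in> \<real> \<and>
    ((sqrt (1 + (real_of_int c)\<^sup>2) - 1) / real_of_int c)\<^sup>2 < Re \<alpha> \<and>
    Re \<alpha> < ((sqrt (1 + (real_of_int c)\<^sup>2) + 1) / real_of_int c)\<^sup>2"
proof -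
  define as where "as = map (\<lambda>i. (-1) ^ i * c) [0..<m]"
  define U where "U = seifert_matrix as"
  have "map (\<lambda>i. (-1) ^ i * (2 * c)) [0..<m] = map (\<lambda>a. 2 * a) as"
    by (simp add: as_def)
  moreover have "as \<noteq> []" "0 \<notin> set as" using assms(1,2) by (auto simp: as_def)
  ultimately have "even_expansion r = as"
    using assms(3) even_expansion_neg_cf[of as] by simp
  then have root: "poly (map_poly of_int (seifert_alexander_poly U)) \<alpha> = 0"
    using assms(4) by (simp add: two_bridge_alexander_poly_def U_def)
  have U: "U \<in> carrier_mat m m" by (simp add: U_def seifert_matrix_def as_def)
  define M where "M = mat m m (\<lambda>(i, j). \<alpha> * of_int (U $$ (i, j)) - of_int (U $$ (j, i)))"
  obtain v where v: "v \<in> carrier_vec m" "v \<noteq> 0\<^sub>v m" "M *\<^sub>v v = 0\<^sub>v m"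
    using root seifert_alexander_poly_zero_iff[OF U] M_def by auto
  define w where "w k = (if k = 0 \<or> k > m then 0 else v $ (k - 1))" for k
  have w0: "w 0 = 0" "w (Suc m) = 0" by (simp_all add: w_def)
  have row: "(\<Sum>j<m. M $$ (i, j) * w (Suc j)) = 0" if "i < m" for i
  proof -
    have "(M *\<^sub>v v) $ i = (\<Sum>j<m. M $$ (i, j) * v $ j)"
      using that v(1) by (simp add: M_def scalar_prod_def atLeast0LessThan)
    then show ?thesis using v(3) that by (simp add: w_def)
  qed
  \<comment> \<open>All off-diagonal entries of \<open>U\<close> lie in odd rows (counted from 0).
    Hence those of \<open>M\<close> come from \<open>\<alpha> U\<close> in odd rows and from
    \<open>- U\<^sup>T\<close> in even rows.\<close>
  have entry: "M $$ (i, j) = (if j = i then (\<alpha> - 1) * (-1) ^ i * of_int c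
      else if i = Suc j then (if odd i then - \<alpha> else - 1)
      else if j = Suc i then (if odd i then \<alpha> else 1) else 0)" if "i < m" "j < m" for i j
    using that by (auto simp: M_def U_def seifert_matrix_def as_def algebra_simps)
  have rec: "(if odd i then - \<alpha> else - 1) * w i + (\<alpha> - 1) * (-1) ^ i * of_int c * w (Suc i)
      + (if odd i then \<alpha> else 1) * w (Suc (Suc i)) = 0" if "i < m" for i
    using sum_tridiagonal[OF that entry[OF that] w0] row[OF that] by simp
  interpret alternating_recurrence "real_of_int c" \<alpha> m w
  proof
    obtain i where "i < m" "v $ i \<noteq> 0" using v(1,2) by (metis eq_vecI carrier_vecD index_zero_vec)
    then show "\<exists>k\<le>m. w k \<noteq> 0" by (intro exI[of _ "Suc i"]) (simp add: w_def)
    show "w (Suc (Suc k)) - w k = - ((\<alpha> - 1) * real_of_int c * w (Suc k))" if "k < m" "even k" for k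
      using rec[of k] that by (simp add: algebra_simps eq_neg_iff_add_eq_0)
    show "\<alpha> * (w (Suc (Suc k)) - w k) = (\<alpha> - 1) * real_of_int c * w (Suc k)" if "k < m" "odd k" for k
      using rec[of k] that by (simp add: algebra_simps eq_neg_iff_add_eq_0)
  qed (use assms(1) w0 in simp_all)
  show ?thesis by (rule location)
qed

end
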